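(* Let $b$ be a non-negative integer. Then for any integer $n$ satisfying $0\leq n\leq b$, the following four identities hold in $\mathcal{A}$: \begin{align*} &\sum_{j=0}^b\left(\binom{j}{n}+\binom{j}{b-n}\right)E_{\mathcal{A}}(b-j+1,j+1)=(-1)^{n+1}S_{\mathcal{A}}(b-n+1,n+1),\\ &\sum_{j=0}^b\binom{j}{n}S_{\mathcal{A}}(b-j+1,j+1)+\sum_{j=0}^b\binom{j}{b-n}t_{\mathcal{A}}(b-j+1,j+1)=(-1)^{n+1}E_{\mathcal{A}}(b-n+1,n+1),\\ &\sum_{j=0}^b\binom{j}{n}t_{\mathcal{A}}(b-j+1,j+1)+\sum_{j=0}^b\binom{j}{b-n}S_{\mathcal{A}}(b-j+1,j+1)=(-1)^{n+1}t_{\mathcal{A}}(b-n+1,n+1),\\ &\sum_{j=0}^b\left(\binom{j}{n}+\binom{j}{b-n}\right)T_{\mathcal{A}}(b-j+1,j+1)=(-1)^{n+1}T_{\mathcal{A}}(b-n+1,n+1). \end{align*}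
   Context: Let $\mathcal{P}$ be the set of primes and $\mathcal{A}:=\prod_{p\in\mathcal{P}}(\mathbb{Z}/p\mathbb{Z})\big/\bigoplus_{p\in\mathcal{P}}(\mathbb{Z}/p\mathbb{Z})$, in which an element is determined by its components at all but finitely many primes. For positive integers $k_1,k_2$ and signs $\varepsilon_1,\varepsilon_2\in\{\pm1\}$, put $$M_{\mathcal{A}}(k_1,k_2;\varepsilon_1,\varepsilon_2):=\Bigl(\sum_{0<m_1<m_2<p}\frac{(1+\varepsilon_1(-1)^{m_1})(1+\varepsilon_2(-1)^{m_2})}{m_1^{k_1}m_2^{k_2}}\bmod p\Bigr)_{p\in\mathcal{P}}\in\mathcal{A}.$$ The depth-two finite multiple $E$-, $S$-, $t$- and $T$-values are $E_{\mathcal{A}}(k_1,k_2):=M_{\mathcal{A}}(k_1,k_2;1,1)$, $S_{\mathcal{A}}(k_1,k_2):=M_{\mathcal{A}}(k_1,k_2;1,-1)$, $t_{\mathcal{A}}(k_1,k_2):=M_{\mathcal{A}}(k_1,k_2;-1,-1)$, $T_{\mathcal{A}}(k_1,k_2):=M_{\mathcal{A}}(k_1,k_2;-1,1)$. Binomial coefficients $\binom{j}{n}$ are $0$ if $n>j$. *)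

theory Defs
  imports "HOL-Number_Theory.Number_Theory"
begin

text \<open>
  An element of the product is the family of its components, each represented by its least
  non-negative residue.  The index type is all of \<^typ>\<open>nat\<close>; the entries at non-primes carry no
  information and are normalised to 0, so that equality of families is equality of all
  components at primes.
\<close>

typedef prime_prod =
  "{f :: nat \<Rightarrow> int. (\<forall>p. prime p \<longrightarrow> f p \<in> {0..<int p}) \<and> (\<forall>p. \<not> prime p \<longrightarrow> f p = 0)}"
  morphisms component Abs_prime_prod
  by (rule exI[of _ "\<lambda>_. 0"]) (auto simp: prime_gt_0_nat)

setup_lifting type_definition_prime_prod

lift_definition residue_family :: "(nat \<Rightarrow> int) \<Rightarrow> prime_prod" is
  "\<lambda>f p. if prime p then f p mod int p else 0"
  by (auto simp: prime_gt_0_nat)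

lemma component_nonprime: "\<not> prime p \<Longrightarrow> component x p = 0"
  by transfer auto

lemma component_mod: "component x p mod int p = component x p"
  by (cases "prime p") (transfer; auto)+

lemma component_residue_family:
  "component (residue_family f) p = (if prime p then f p mod int p else 0)"
  by (simp add: residue_family.rep_eq)

lemma prime_prod_eqI: "(\<And>p. prime p \<Longrightarrow> component x p = component y p) \<Longrightarrow> x = y"
  by (metis component_inject component_nonprime ext)

instantiation prime_prod :: comm_ring_1
begin

definition "0 = residue_family (\<lambda>_. 0)"
definition "1 = residue_family (\<lambda>_. 1)"
definition "x + y = residue_family (\<lambda>p. component x p + component y p)"
definition "x - y = residue_family (\<lambda>p. component x p - component y p)"
definition "- x = residue_family (\<lambda>p. - component x p)"
definition "x * y = residue_family (\<lambda>p. component x p * component y p)"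

lemmas prime_prod_ops = zero_prime_prod_def one_prime_prod_def plus_prime_prod_def
  minus_prime_prod_def uminus_prime_prod_def times_prime_prod_def

instance
proof
  show "(0 :: prime_prod) \<noteq> 1"
  proof
    assume "(0 :: prime_prod) = 1"
    then have "component 0 2 = component 1 2" by simp
    then show False by (simp add: prime_prod_ops component_residue_family)
  qed
qed (rule prime_prod_eqI;
     simp add: prime_prod_ops component_residue_family component_mod mod_simps algebra_simps)+

end

definition direct_sum :: "prime_prod set" where
  "direct_sum = {x. finite {p. prime p \<and> component x p \<noteq> 0}}"

lemma direct_sum_0: "0 \<in> direct_sum"
  by (simp add: direct_sum_def prime_prod_ops component_residue_family)

lemma direct_sum_add: "x \<in> direct_sum \<Longrightarrow> y \<in> direct_sum \<Longrightarrow> x + y \<in> direct_sum"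
  unfolding direct_sum_def mem_Collect_eq
  by (rule finite_subset[of _ "{p. prime p \<and> component x p \<noteq> 0} \<union> {p. prime p \<and> component y p \<noteq> 0}"])
     (auto simp: prime_prod_ops component_residue_family)

lemma direct_sum_mult: "x \<in> direct_sum \<Longrightarrow> r * x \<in> direct_sum"
  unfolding direct_sum_def mem_Collect_eq
  by (rule finite_subset[of _ "{p. prime p \<and> component x p \<noteq> 0}"])
     (auto simp: prime_prod_ops component_residue_family)

lemma direct_sum_uminus: "x \<in> direct_sum \<Longrightarrow> - x \<in> direct_sum"
  using direct_sum_mult[of x "- 1"] by simp

quotient_type ring_A = prime_prod / "\<lambda>x y. x - y \<in> direct_sum"
  morphisms rep_A class_A
proof (rule equivpI)
  show "reflp (\<lambda>x y. x - y \<in> direct_sum)"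
    by (simp add: reflp_def direct_sum_0)
  show "symp (\<lambda>x y. x - y \<in> direct_sum)"
    using direct_sum_uminus by (fastforce simp: symp_def)
  show "transp (\<lambda>x y. x - y \<in> direct_sum)"
    using direct_sum_add by (fastforce simp: transp_def)
qed

instantiation ring_A :: comm_ring_1
begin

lift_definition zero_ring_A :: ring_A is 0 .
lift_definition one_ring_A :: ring_A is 1 .

lift_definition plus_ring_A :: "ring_A \<Rightarrow> ring_A \<Rightarrow> ring_A" is "(+)"
  using direct_sum_add by (fastforce simp: algebra_simps)

lift_definition minus_ring_A :: "ring_A \<Rightarrow> ring_A \<Rightarrow> ring_A" is "(-)"
proof -
  fix x x' y y' :: prime_prod
  assume "x - x' \<in> direct_sum" "y - y' \<in> direct_sum"
  then have "(x - x') + - (y - y') \<in> direct_sum"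
    by (intro direct_sum_add direct_sum_uminus)
  then show "(x - y) - (x' - y') \<in> direct_sum"
    by (simp add: algebra_simps)
qed

lift_definition uminus_ring_A :: "ring_A \<Rightarrow> ring_A" is uminus
  using direct_sum_uminus by fastforce

lift_definition times_ring_A :: "ring_A \<Rightarrow> ring_A \<Rightarrow> ring_A" is "(*)"
proof -
  fix x x' y y' :: prime_prod
  assume "x - x' \<in> direct_sum" "y - y' \<in> direct_sum"
  then have "y * (x - x') + x' * (y - y') \<in> direct_sum"
    by (intro direct_sum_add direct_sum_mult)
  then show "x * y - x' * y' \<in> direct_sum"
    by (simp add: algebra_simps)
qed

instance
proof
  show "(0 :: ring_A) \<noteq> 1"
  proof (transfer, rule notI)
    assume "(0 :: prime_prod) - 1 \<in> direct_sum"
    then have "1 \<in> direct_sum"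
      using direct_sum_uminus[of "0 - 1"] by simp
    moreover have "{p. prime p \<and> component 1 p \<noteq> 0} = {p :: nat. prime p}"
      by (auto simp: prime_prod_ops component_residue_family zmod_trivial_iff dest: prime_gt_1_nat)
    ultimately show False
      using primes_infinite by (simp add: direct_sum_def)
  qed
qed (transfer; simp add: algebra_simps direct_sum_0)+

end

text \<open>The class of a family of residues, given by arbitrary integer representatives.\<close>

definition class_of_family :: "(nat \<Rightarrow> int) \<Rightarrow> ring_A" where
  "class_of_family f = class_A (residue_family f)"

lemma class_of_family_eq_iff:
  "class_of_family f = class_of_family g \<longleftrightarrow> finite {p. prime p \<and> \<not> [f p = g p] (mod int p)}"
proof -
  have "(f p mod int p - g p mod int p) mod int p = 0 \<longleftrightarrow> [f p = g p] (mod int p)" for p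
    by (simp add: mod_simps cong_iff_dvd_diff mod_eq_0_iff_dvd)
  then show ?thesis
    by (simp add: class_of_family_def ring_A.abs_eq_iff direct_sum_def prime_prod_ops
        component_residue_family cong: conj_cong)
qed

text \<open>
  For prime \<open>p\<close> and \<open>0 < m\<^sub>1 < m\<^sub>2 < p\<close> both indices are units modulo \<open>p\<close>, so the reciprocal of the
  denominator in the residue field at \<open>p\<close> is the modular inverse.
\<close>

definition M_A :: "nat \<Rightarrow> nat \<Rightarrow> int \<Rightarrow> int \<Rightarrow> ring_A" where
  "M_A k1 k2 \<epsilon>1 \<epsilon>2 = class_of_family (\<lambda>p.
     \<Sum>(m1, m2) | 0 < m1 \<and> m1 < m2 \<and> m2 < p.
       (1 + \<epsilon>1 * (-1) ^ m1) * (1 + \<epsilon>2 * (-1) ^ m2) *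
       modular_inverse (int p) (int m1 ^ k1 * int m2 ^ k2))"

definition E_A :: "nat \<Rightarrow> nat \<Rightarrow> ring_A" where "E_A k1 k2 = M_A k1 k2 1 1"
definition S_A :: "nat \<Rightarrow> nat \<Rightarrow> ring_A" where "S_A k1 k2 = M_A k1 k2 1 (-1)"
definition t_A :: "nat \<Rightarrow> nat \<Rightarrow> ring_A" where "t_A k1 k2 = M_A k1 k2 (-1) (-1)"
definition T_A :: "nat \<Rightarrow> nat \<Rightarrow> ring_A" where "T_A k1 k2 = M_A k1 k2 (-1) 1"

end

theory Submission
  imports Defs
begin

text \<open>
  For \<open>x, y > 0\<close> with \<open>x + y < p\<close> the reciprocals \<open>X, Y, Z\<close> of \<open>x, y, x + y\<close> modulo \<open>p\<close> satisfy
  \<open>X Y = Z (X + Y)\<close>, and iterating this yields the partial fraction expansion of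
  \<open>X\<^bsup>r+1\<^esup> Y\<^bsup>s+1\<^esup>\<close> into terms \<open>X\<^bsup>i\<^esup> Z\<^bsup>k\<^esup>\<close> and \<open>Y\<^bsup>i\<^esup> Z\<^bsup>k\<^esup>\<close>. Sum it over all such
  \<open>(x, y)\<close> with prescribed parities, which also fix the parity of \<open>x + y\<close>. The expansion
  becomes the left-hand sides, with \<open>m\<^sub>2 = x + y\<close> and \<open>m\<^sub>1 = x\<close> or \<open>m\<^sub>1 = y\<close>. On the unexpanded side
  put \<open>y = p - z\<close>: then \<open>1/y\<close> becomes \<open>-1/z\<close>, the condition \<open>x + y < p\<close> becomes \<open>x < z\<close>, and the
  parity flips as \<open>p\<close> is odd. Thus all four identities are instances of one with two signs.
\<close>

section \<open>Partial fraction expansion\<close>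

definition partial_fractions :: "'a::comm_semiring_1 \<Rightarrow> 'a \<Rightarrow> 'a \<Rightarrow> nat \<Rightarrow> nat \<Rightarrow> 'a" where
  "partial_fractions X Y Z r s =
     (\<Sum>j=0..r+s. of_nat (j choose s) * (X ^ (r + s - j + 1) * Z ^ (j + 1))) +
     (\<Sum>j=0..r+s. of_nat (j choose r) * (Y ^ (r + s - j + 1) * Z ^ (j + 1)))"

lemma partial_fractions_commute: "partial_fractions X Y Z r s = partial_fractions Y X Z s r"
  by (simp add: partial_fractions_def add.commute)

lemma sum_choose_zero_right:
  "(\<Sum>j=0..s. of_nat (j choose s) * f j) = (f s :: 'a::comm_semiring_1)"
proof -
  have "(\<Sum>j=0..s. of_nat (j choose s) * f j) = (\<Sum>j=0..s. if j = s then f j else 0)"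
    by (rule sum.cong) (auto simp: binomial_eq_0)
  then show ?thesis by simp
qed

lemma partial_fractions_0:
  "partial_fractions X Y Z 0 s = X * Z ^ (s + 1) + (\<Sum>j=0..s. Y ^ (s - j + 1) * Z ^ (j + 1))"
  by (simp add: partial_fractions_def sum_choose_zero_right)

text \<open>Boundary case of the recursion in \<open>partial_fractions_Suc_Suc\<close>: the bare
  power of \<open>Y\<close> takes the place of the missing expansion with exponent 0 on
  \<open>X\<close>.\<close>

lemma partial_fractions_0_Suc:
  "partial_fractions X Y Z 0 (Suc s) = Z * (partial_fractions X Y Z 0 s + Y ^ Suc (Suc s))"
  by (simp add: partial_fractions_0 sum.atLeast0_atMost_Suc_shift
      sum_distrib_left algebra_simps del: sum.cl_ivl_Suc)

text \<open>Pascal's rule after shifting \<open>j\<close>; the term at \<open>j = 0\<close> vanishes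
  because the lower index is positive.\<close>

lemma sum_choose_Suc:
  fixes f :: "nat \<Rightarrow> 'a::comm_semiring_1"
  shows "(\<Sum>j=0..Suc m. of_nat (j choose Suc k) * f j) =
    (\<Sum>j=0..m. of_nat (j choose k) * f (Suc j)) + (\<Sum>j=0..m. of_nat (j choose Suc k) * f (Suc j))"
  by (simp add: sum.atLeast0_atMost_Suc_shift sum.distrib algebra_simps del: sum.cl_ivl_Suc)

lemma partial_fractions_Suc_Suc:
  "partial_fractions X Y Z (Suc r) (Suc s) =
     Z * (partial_fractions X Y Z (Suc r) s + partial_fractions X Y Z r (Suc s))"
  unfolding partial_fractions_def add_Suc add_Suc_right sum_choose_Suc
  by (simp add: sum_distrib_left algebra_simps del: sum.cl_ivl_Suc)

text \<open>Both sides obey the same recursion: replacing one factor \<open>X * Y\<close> by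
  \<open>Z * (X + Y)\<close> lowers either exponent by one, and Pascal's rule does the same for the
  binomial sums.\<close>

lemma partial_fraction_expansion:
  fixes X Y Z m :: int
  assumes XYZ: "[X * Y = Z * (X + Y)] (mod m)"
  shows "[X ^ Suc r * Y ^ Suc s = partial_fractions X Y Z r s] (mod m)"
proof -
  have step: "[X ^ Suc r * Y ^ Suc s = Z * (F + G)] (mod m)"
    if XYZ: "[X * Y = Z * (X + Y)] (mod m)"
      and F: "[X ^ Suc r * Y ^ s = F] (mod m)" and G: "[X ^ r * Y ^ Suc s = G] (mod m)"
    for X Y r s F G
  proof -
    have "X ^ Suc r * Y ^ Suc s = X * Y * (X ^ r * Y ^ s)" by simp
    also have "[\<dots> = Z * (X + Y) * (X ^ r * Y ^ s)] (mod m)"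
      by (intro cong_mult XYZ cong_refl)
    also have "Z * (X + Y) * (X ^ r * Y ^ s) = Z * (X ^ Suc r * Y ^ s + X ^ r * Y ^ Suc s)"
      by (simp add: algebra_simps)
    also have "[\<dots> = Z * (F + G)] (mod m)"
      by (intro cong_mult cong_add F G cong_refl)
    finally show ?thesis .
  qed
  \<comment> \<open>Stated for all \<open>X\<close> and \<open>Y\<close>, since the case
    \<open>s = 0\<close> below needs it with the two exchanged.\<close>
  have base: "[X ^ Suc 0 * Y ^ Suc s = partial_fractions X Y Z 0 s] (mod m)"
    if "[X * Y = Z * (X + Y)] (mod m)" for X Y s
    using that
  proof (induction s)
    case 0
    then show ?case by (simp add: partial_fractions_0 algebra_simps)
  next
    case (Suc s)
    show ?case unfolding partial_fractions_0_Suc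
      by (rule step[OF Suc.prems Suc.IH[OF Suc.prems]]) simp
  qed
  show ?thesis
  proof (induction r arbitrary: s)
    case 0
    show ?case by (rule base[OF XYZ])
  next
    case (Suc r)
    note outer = Suc
    show ?case
    proof (induction s)
      case 0
      have "[Y * X = Z * (Y + X)] (mod m)" using XYZ by (simp add: ac_simps)
      from base[OF this] show ?case
        by (subst partial_fractions_commute, subst mult.commute)
    next
      case (Suc s)
      show ?case unfolding partial_fractions_Suc_Suc
        by (rule step[OF XYZ Suc outer])
    qed
  qed
qed

section \<open>Compatibility of the class map with the ring operations\<close>

lemma class_of_family_0: "class_of_family (\<lambda>_. 0) = 0"
  by (simp add: class_of_family_def zero_ring_A_def zero_prime_prod_def)

lemma class_of_family_1: "class_of_family (\<lambda>_. 1) = 1"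
  by (simp add: class_of_family_def one_ring_A_def one_prime_prod_def)

lemma class_of_family_add:
  "class_of_family f + class_of_family g = class_of_family (\<lambda>p. f p + g p)"
proof -
  have "residue_family f + residue_family g = residue_family (\<lambda>p. f p + g p)"
    by (rule prime_prod_eqI)
      (simp add: plus_prime_prod_def component_residue_family mod_simps)
  then show ?thesis
    by (simp add: class_of_family_def plus_ring_A.abs_eq)
qed

lemma class_of_family_mult:
  "class_of_family f * class_of_family g = class_of_family (\<lambda>p. f p * g p)"
proof -
  have "residue_family f * residue_family g = residue_family (\<lambda>p. f p * g p)"
    by (rule prime_prod_eqI)
      (simp add: times_prime_prod_def component_residue_family mod_simps)
  then show ?thesis
    by (simp add: class_of_family_def times_ring_A.abs_eq)
qed

lemma class_of_family_uminus: "- class_of_family f = class_of_family (\<lambda>p. - f p)"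
  by (rule minus_unique) (simp add: class_of_family_add class_of_family_0)

lemma class_of_family_of_nat: "of_nat k = class_of_family (\<lambda>_. int k)"
  by (induction k) (simp_all add: class_of_family_0 flip: class_of_family_1 class_of_family_add)

lemma class_of_family_minus_1_power: "(-1) ^ k = class_of_family (\<lambda>_. (-1) ^ k)"
  by (induction k)
    (simp_all add: class_of_family_1 class_of_family_uminus flip: class_of_family_mult)

lemma class_of_family_sum:
  "(\<Sum>i\<in>A. class_of_family (f i)) = class_of_family (\<lambda>p. \<Sum>i\<in>A. f i p)"
  by (induction A rule: infinite_finite_induct)
    (simp_all add: class_of_family_0 class_of_family_add)

section \<open>Inverses modulo a prime, compared by multiplying back\<close>

lemma cong_right_inverse_unique:
  fixes u v w m :: int
  assumes "[w * u = 1] (mod m)" and "[w * v = 1] (mod m)"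
  shows "[u = v] (mod m)"
proof -
  have "[u = u * (w * v)] (mod m)"
    using cong_mult[OF cong_refl[of u] cong_sym[OF assms(2)]] by simp
  also have "u * (w * v) = w * u * v" by simp
  also have "[\<dots> = v] (mod m)"
    using cong_mult[OF assms(1) cong_refl[of v]] by simp
  finally show ?thesis .
qed

lemma coprime_less_prime: "prime p \<Longrightarrow> 0 < m \<Longrightarrow> m < p \<Longrightarrow> coprime m (p :: nat)"
  by (metis coprime_commute nat_dvd_not_less prime_imp_coprime_nat)

definition parity_weight :: "int \<Rightarrow> nat \<Rightarrow> int" where
  "parity_weight \<epsilon> m = 1 + \<epsilon> * (-1) ^ m"

definition reciprocal :: "nat \<Rightarrow> nat \<Rightarrow> int" where
  "reciprocal p m = modular_inverse (int p) (int m)"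

definition double_sum :: "nat \<Rightarrow> int \<Rightarrow> int \<Rightarrow> nat \<Rightarrow> nat \<Rightarrow> int" where
  "double_sum p \<epsilon>1 \<epsilon>2 k1 k2 = (\<Sum>(m1, m2) | 0 < m1 \<and> m1 < m2 \<and> m2 < p.
     parity_weight \<epsilon>1 m1 * parity_weight \<epsilon>2 m2 * (reciprocal p m1 ^ k1 * reciprocal p m2 ^ k2))"

lemma reciprocal_cong:
  "prime p \<Longrightarrow> 0 < m \<Longrightarrow> m < p \<Longrightarrow> [int m * reciprocal p m = 1] (mod int p)"
  unfolding reciprocal_def by (intro cong_modular_inverse1) (simp add: coprime_less_prime)

text \<open>The inverse of the product and the product of the inverse powers both invert the same
  denominator, so the two families agree at every prime. The split form is the one to which partial
  fractions apply.\<close>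

lemma M_A_eq_double_sum:
  "M_A k1 k2 \<epsilon>1 \<epsilon>2 = class_of_family (\<lambda>p. double_sum p \<epsilon>1 \<epsilon>2 k1 k2)"
proof -
  have "[modular_inverse (int p) (int m1 ^ k1 * int m2 ^ k2)
      = reciprocal p m1 ^ k1 * reciprocal p m2 ^ k2] (mod int p)"
    if p: "prime p" and m: "0 < m1" "m1 < m2" "m2 < p" for p m1 m2
  proof (rule cong_right_inverse_unique)
    show "[int m1 ^ k1 * int m2 ^ k2 * modular_inverse (int p) (int m1 ^ k1 * int m2 ^ k2) = 1] (mod int p)"
      using p m by (intro cong_modular_inverse1) (simp add: coprime_less_prime)
    have "[(int m1 * reciprocal p m1) ^ k1 * (int m2 * reciprocal p m2) ^ k2 = 1 ^ k1 * 1 ^ k2] (mod int p)"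
      using p m by (intro cong_mult cong_pow reciprocal_cong) auto
    then show "[int m1 ^ k1 * int m2 ^ k2 * (reciprocal p m1 ^ k1 * reciprocal p m2 ^ k2) = 1] (mod int p)"
      by (simp add: power_mult_distrib ac_simps)
  qed
  then have "{p. prime p \<and> \<not> [(\<Sum>(m1, m2) | 0 < m1 \<and> m1 < m2 \<and> m2 < p.
       (1 + \<epsilon>1 * (-1) ^ m1) * (1 + \<epsilon>2 * (-1) ^ m2) *
       modular_inverse (int p) (int m1 ^ k1 * int m2 ^ k2)) = double_sum p \<epsilon>1 \<epsilon>2 k1 k2] (mod int p)} = {}"
    unfolding double_sum_def parity_weight_def
    by (auto intro!: cong_sum cong_mult cong_refl split: prod.splits)
  then show ?thesis
    unfolding M_A_def class_of_family_eq_iff by (simp only: finite.emptyI)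
qed

section \<open>Substitutions in indices, reciprocals and parity weights\<close>

lemma double_sum_left:
  "double_sum p \<epsilon>1 \<epsilon>2 k1 k2 = (\<Sum>(x, y) | 0 < x \<and> 0 < y \<and> x + y < p.
     parity_weight \<epsilon>1 x * parity_weight \<epsilon>2 (x + y) * (reciprocal p x ^ k1 * reciprocal p (x + y) ^ k2))"
  unfolding double_sum_def
  by (rule sum.reindex_bij_witness[where i = "\<lambda>(x, y). (x, x + y)" and j = "\<lambda>(m1, m2). (m1, m2 - m1)"])
    auto

lemma double_sum_right:
  "double_sum p \<epsilon>1 \<epsilon>2 k1 k2 = (\<Sum>(x, y) | 0 < x \<and> 0 < y \<and> x + y < p.
     parity_weight \<epsilon>1 y * parity_weight \<epsilon>2 (x + y) * (reciprocal p y ^ k1 * reciprocal p (x + y) ^ k2))"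
  unfolding double_sum_def
  by (rule sum.reindex_bij_witness[where i = "\<lambda>(x, y). (y, x + y)" and j = "\<lambda>(m1, m2). (m2 - m1, m1)"])
    auto

lemma double_sum_reflect:
  "double_sum p \<epsilon>1 \<epsilon>2 k1 k2 = (\<Sum>(x, y) | 0 < x \<and> 0 < y \<and> x + y < p.
     parity_weight \<epsilon>1 x * parity_weight \<epsilon>2 (p - y) * (reciprocal p x ^ k1 * reciprocal p (p - y) ^ k2))"
  unfolding double_sum_def
  by (rule sum.reindex_bij_witness[where i = "\<lambda>(x, y). (x, p - y)" and j = "\<lambda>(m1, m2). (m1, p - m2)"])
    auto

lemma reciprocal_reflect:
  assumes p: "prime p" and y: "0 < y" "y < p"
  shows "[reciprocal p y = - reciprocal p (p - y)] (mod int p)"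
proof (rule cong_right_inverse_unique)
  show "[int y * reciprocal p y = 1] (mod int p)" using assms by (rule reciprocal_cong)
  have "[int y * - reciprocal p (p - y) = int (p - y) * reciprocal p (p - y)] (mod int p)"
    using y by (simp add: cong_iff_dvd_diff of_nat_diff algebra_simps)
  also have "[int (p - y) * reciprocal p (p - y) = 1] (mod int p)"
    using assms by (intro reciprocal_cong) auto
  finally show "[int y * - reciprocal p (p - y) = 1] (mod int p)" .
qed

text \<open>This is 1/(xy) = (1/x + 1/y)/(x + y); the bound \<open>x + y < p\<close> makes
  \<open>x + y\<close> a unit.\<close>

lemma reciprocal_add:
  assumes p: "prime p" and xy: "0 < x" "0 < y" "x + y < p"
  shows "[reciprocal p x * reciprocal p y = reciprocal p (x + y) * (reciprocal p x + reciprocal p y)]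
    (mod int p)"
proof (rule cong_right_inverse_unique)
  have X: "[int x * reciprocal p x = 1] (mod int p)" and Y: "[int y * reciprocal p y = 1] (mod int p)"
    and Z: "[int (x + y) * reciprocal p (x + y) = 1] (mod int p)"
    using assms by (auto intro!: reciprocal_cong simp del: of_nat_add)
  show "[int x * int y * (reciprocal p x * reciprocal p y) = 1] (mod int p)"
    using cong_mult[OF X Y] by (simp add: ac_simps)
  have "int x * int y * (reciprocal p (x + y) * (reciprocal p x + reciprocal p y)) =
      reciprocal p (x + y) * (int y * (int x * reciprocal p x) + int x * (int y * reciprocal p y))"
    by (simp add: algebra_simps)
  also have "[\<dots> = reciprocal p (x + y) * (int y * 1 + int x * 1)] (mod int p)"
    by (intro cong_mult cong_add X Y cong_refl)
  also have "reciprocal p (x + y) * (int y * 1 + int x * 1) = int (x + y) * reciprocal p (x + y)"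
    by (simp add: algebra_simps)
  also note Z
  finally show "[int x * int y * (reciprocal p (x + y) * (reciprocal p x + reciprocal p y)) = 1] (mod int p)" .
qed

text \<open>Here \<open>\<delta>\<close> is a sign. The factor at \<open>x\<close> vanishes unless
  \<open>\<delta> * (-1) ^ x = 1\<close>, and then the second factors on the two sides
  coincide.\<close>

lemma parity_weight_add:
  assumes "\<delta> * \<delta> = 1"
  shows "parity_weight \<delta> x * parity_weight (\<delta> * \<eta>) (x + y) = parity_weight \<delta> x * parity_weight \<eta> y"
proof -
  have "(1 + \<delta> * u) * (1 + \<delta> * \<eta> * (u * v)) = (1 + \<delta> * u) * (1 + \<eta> * v)" if "u * u = 1" for u v
  proof -
    \<comment> \<open>The difference factors as
      \<open>\<eta> * v * (\<delta> * u + 1) * (\<delta> * u - 1)\<close>.\<close>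
    have "(1 + \<delta> * u) * (1 + \<delta> * \<eta> * (u * v)) - (1 + \<delta> * u) * (1 + \<eta> * v)
        = \<eta> * v * ((\<delta> * \<delta>) * (u * u) - 1)"
      by (simp only: algebra_simps)
    then show ?thesis using assms that by simp
  qed
  moreover have "(-1::int) ^ x * (-1) ^ x = 1" by (simp flip: power_mult_distrib)
  ultimately show ?thesis unfolding parity_weight_def power_add by blast
qed

text \<open>For odd \<open>p\<close>, the numbers \<open>y\<close> and \<open>p - y\<close> have
  opposite parity, which the change of sign compensates.\<close>

lemma parity_weight_reflect:
  assumes "odd p" and "y < p"
  shows "parity_weight (- \<eta>) (p - y) = parity_weight \<eta> y"
  using assms by (cases "even y") (auto simp: parity_weight_def)

section \<open>The two-sign identity, modulo odd primes and then in \<open>ring_A\<close>\<close>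

lemma double_sum_identity:
  assumes p: "prime p" "odd p" and \<delta>: "\<delta> * \<delta> = 1" and \<eta>: "\<eta> * \<eta> = 1"
  shows "[(\<Sum>j=0..r+s. int (j choose s) * double_sum p \<delta> (\<delta> * \<eta>) (r + s - j + 1) (j + 1)) +
      (\<Sum>j=0..r+s. int (j choose r) * double_sum p \<eta> (\<delta> * \<eta>) (r + s - j + 1) (j + 1)) =
      (-1) ^ (s + 1) * double_sum p \<delta> (- \<eta>) (r + 1) (s + 1)] (mod int p)"
    (is "[?L = ?R] (mod int p)")
proof -
  define A where "A = {(x, y). 0 < x \<and> 0 < y \<and> x + y < p}"
  \<comment> \<open>All the double sums involved carry this one weight on the triangle
    \<open>A\<close>, so a congruence for each pair \<open>(x, y)\<close> suffices.\<close>
  define w where "w = (\<lambda>(x, y). parity_weight \<delta> x * parity_weight \<eta> y)"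
  let ?I = "reciprocal p"
  have left: "double_sum p \<delta> (\<delta> * \<eta>) k1 k2 = (\<Sum>(x, y)\<in>A. w (x, y) * (?I x ^ k1 * ?I (x + y) ^ k2))"
    for k1 k2
    unfolding double_sum_left A_def w_def by (simp add: parity_weight_add[OF \<delta>])
  have right: "double_sum p \<eta> (\<delta> * \<eta>) k1 k2 = (\<Sum>(x, y)\<in>A. w (x, y) * (?I y ^ k1 * ?I (x + y) ^ k2))"
    for k1 k2
  proof -
    have "parity_weight \<eta> y * parity_weight (\<delta> * \<eta>) (x + y) = w (x, y)" for x y
      \<comment> \<open>The same absorption of parities, with the roles of \<open>x\<close>,
        \<open>\<delta>\<close> and \<open>y\<close>, \<open>\<eta>\<close> exchanged.\<close>
      using parity_weight_add[OF \<eta>, of y \<delta> x] by (simp add: w_def ac_simps)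
    then show ?thesis unfolding double_sum_right A_def by simp
  qed
  have "?L = (\<Sum>(x, y)\<in>A. w (x, y) * partial_fractions (?I x) (?I y) (?I (x + y)) r s)"
    unfolding left right partial_fractions_def distrib_left sum_distrib_left split_def sum.distrib
    by (subst (1 2) sum.swap) (simp add: ac_simps)
  also have "[\<dots> = (\<Sum>(x, y)\<in>A. w (x, y) * (?I x ^ Suc r * ?I y ^ Suc s))] (mod int p)"
    using p by (intro cong_sum)
      (auto simp: A_def simp del: power_Suc intro!: cong_mult cong_refl
        cong_sym[OF partial_fraction_expansion[OF reciprocal_add]])
  also have "[(\<Sum>(x, y)\<in>A. w (x, y) * (?I x ^ Suc r * ?I y ^ Suc s)) =
      (\<Sum>(x, y)\<in>A. w (x, y) * (?I x ^ Suc r * (- ?I (p - y)) ^ Suc s))] (mod int p)"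
    using p by (intro cong_sum)
      (auto simp: A_def simp del: power_Suc intro!: cong_mult cong_pow cong_refl reciprocal_reflect)
  \<comment> \<open>The \<open>s + 1\<close> minus signs give the power of -1, and reflecting the
    parity turns \<open>\<eta>\<close> into \<open>- \<eta>\<close>.\<close>
  also have "(\<Sum>(x, y)\<in>A. w (x, y) * (?I x ^ Suc r * (- ?I (p - y)) ^ Suc s)) = ?R"
    unfolding double_sum_reflect sum_distrib_left A_def w_def
    using p by (intro sum.cong)
      (auto simp: parity_weight_reflect power_minus[of "reciprocal p _"] ac_simps simp del: power_Suc)
  finally show ?thesis .
qed

lemma M_A_identity:
  assumes n: "n \<le> b" and \<delta>: "\<delta> * \<delta> = 1" and \<eta>: "\<eta> * \<eta> = 1"
  shows "(\<Sum>j=0..b. of_nat (j choose n) * M_A (b - j + 1) (j + 1) \<delta> (\<delta> * \<eta>)) +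
      (\<Sum>j=0..b. of_nat (j choose (b - n)) * M_A (b - j + 1) (j + 1) \<eta> (\<delta> * \<eta>)) =
      (-1) ^ (n + 1) * M_A (b - n + 1) (n + 1) \<delta> (- \<eta>)"
proof -
  define F where "F p = (\<Sum>j=0..b. int (j choose n) * double_sum p \<delta> (\<delta> * \<eta>) (b - j + 1) (j + 1)) +
      (\<Sum>j=0..b. int (j choose (b - n)) * double_sum p \<eta> (\<delta> * \<eta>) (b - j + 1) (j + 1))" for p
  define G where "G p = (-1) ^ (n + 1) * double_sum p \<delta> (- \<eta>) (b - n + 1) (n + 1)" for p
  have "[F p = G p] (mod int p)" if "prime p" "odd p" for p
    using double_sum_identity[OF that \<delta> \<eta>, where r = "b - n" and s = n] n by (simp add: F_def G_def)
  \<comment> \<open>The prime 2 may fail, but a single component does not affect the class in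
    \<open>ring_A\<close>.\<close>
  then have "{p. prime p \<and> \<not> [F p = G p] (mod int p)} \<subseteq> {2}"
    using primes_dvd_imp_eq two_is_prime_nat by blast
  then have "class_of_family F = class_of_family G"
    unfolding class_of_family_eq_iff by (rule finite_subset) simp
  then show ?thesis
    unfolding M_A_eq_double_sum class_of_family_of_nat class_of_family_minus_1_power
      class_of_family_mult class_of_family_sum class_of_family_add F_def G_def .
qed

theorem mainTheorem5:
  fixes b n :: nat
  assumes "n \<le> b"
  shows "(\<Sum>j=0..b. of_nat ((j choose n) + (j choose (b - n))) * E_A (b - j + 1) (j + 1))
           = (-1) ^ (n + 1) * S_A (b - n + 1) (n + 1)
    \<and> (\<Sum>j=0..b. of_nat (j choose n) * S_A (b - j + 1) (j + 1))
           + (\<Sum>j=0..b. of_nat (j choose (b - n)) * t_A (b - j + 1) (j + 1))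
           = (-1) ^ (n + 1) * E_A (b - n + 1) (n + 1)
    \<and> (\<Sum>j=0..b. of_nat (j choose n) * t_A (b - j + 1) (j + 1))
           + (\<Sum>j=0..b. of_nat (j choose (b - n)) * S_A (b - j + 1) (j + 1))
           = (-1) ^ (n + 1) * t_A (b - n + 1) (n + 1)
    \<and> (\<Sum>j=0..b. of_nat ((j choose n) + (j choose (b - n))) * T_A (b - j + 1) (j + 1))
           = (-1) ^ (n + 1) * T_A (b - n + 1) (n + 1)"
  \<comment> \<open>The sign pairs yield the four identities in order. In the first and the last,
    \<open>\<delta> = \<eta>\<close>, so both sums run over the same values and the binomials add
    up.\<close>
  using M_A_identity[OF assms, of 1 1] M_A_identity[OF assms, of 1 "-1"]
    M_A_identity[OF assms, of "-1" 1] M_A_identity[OF assms, of "-1" "-1"]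
  by (simp add: E_A_def S_A_def t_A_def T_A_def distrib_right sum.distrib)

end
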